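(* Let $n\ge 1$ and $k\ge 1$ be integers, let $\Omega\subset\mathbb{R}^n$ be an open set, and let $0<s<1<p<\infty$ with $sp=n$. Then the following are equivalent: (i) (fractional Moser-Trudinger inequality of order $k$) for some $\alpha$ with $0<\alpha<\alpha^*_{s,n}$, $$\sup_{u\in\tilde W^{s,p}_0(\Omega),\ [u]_{s,p,\mathbb{R}^n}\le 1}\ \int_{\Omega}\Psi_k\big(\alpha|u(x)|^{\frac{p}{p-1}}\big)\,dx<\infty;$$ (ii) (fractional $\left(\frac{kp}{p-1},p\right)$-Poincaré type inequality) $$\inf_{u\in\tilde W^{s,p}_0(\Omega),\ u\ne 0}\ \frac{\displaystyle\int_{\mathbb{R}^n}\int_{\mathbb{R}^n}\frac{|u(x)-u(y)|^p}{|x-y|^{2n}}\,dx\,dy}{\Big(\displaystyle\int_{\Omega}|u(x)|^{\frac{kp}{p-1}}dx\Big)^{\frac{p-1}{k}}}>0.$$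
   Context: For $0<s<1\le p<\infty$, $[u]_{s,p,\mathbb{R}^n}=\Big(\int_{\mathbb{R}^n}\int_{\mathbb{R}^n}\frac{|u(x)-u(y)|^p}{|x-y|^{n+sp}}dx\,dy\Big)^{1/p}$ is the Gagliardo semi-norm and $\|u\|_{s,p,\mathbb{R}^n}=(\|u\|_{L^p(\mathbb{R}^n)}^p+[u]_{s,p,\mathbb{R}^n}^p)^{1/p}$. The space $\tilde W^{s,p}_0(\Omega)$ is the closure of $C_c^\infty(\Omega)$ (functions extended by zero to $\mathbb{R}^n$) with respect to $\|\cdot\|_{s,p,\mathbb{R}^n}$. The $k$-th order truncated exponential is $\Psi_k(x)=e^x-\sum_{j=0}^{k-1}\frac{x^j}{j!}$. For $sp=n$ the constant $\alpha^*_{s,n}$ is $$\alpha^*_{s,n}=n(\gamma_{s,n})^{\frac{s}{n-s}},\qquad \gamma_{s,n}=\frac{2\omega_{n-1}^2\,\Gamma(p+1)}{n!}\sum_{k=0}^{\infty}\frac{(n+k-1)!}{k!\,(n+2k)^p},\qquad \omega_{n-1}=\frac{n\pi^{n/2}}{\Gamma(1+\frac n2)}.$$ Note that $\frac{p}{p-1}=\frac{n}{n-s}$ when $sp=n$. *)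

theory Defs
  imports "HOL-Analysis.Analysis"
begin

text \<open>
  Integrals of nonnegative functions are nonnegative integrals with values in \<open>[0, \<infinity>]\<close>.
  The power below is meant for exponents \<open>a > 0\<close>, for which \<open>\<infinity>\<close> to the power \<open>a\<close> is \<open>\<infinity>\<close>.
\<close>

definition ennpowr :: "ennreal \<Rightarrow> real \<Rightarrow> ennreal" where
  "ennpowr t a = (if t = \<infinity> then \<infinity> else ennreal (enn2real t powr a))"

definition gagliardo_seminorm :: "real \<Rightarrow> real \<Rightarrow> (real ^ 'n \<Rightarrow> real) \<Rightarrow> ennreal" where
  "gagliardo_seminorm s p u = ennpowr
     (\<integral>\<^sup>+ y. (\<integral>\<^sup>+ x. ennreal (\<bar>u x - u y\<bar> powr p / norm (x - y) powr (real CARD('n) + s * p)) \<partial>lborel) \<partial>lborel)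
     (1 / p)"

definition lp_norm :: "real \<Rightarrow> (real ^ 'n \<Rightarrow> real) \<Rightarrow> ennreal" where
  "lp_norm p u = ennpowr (\<integral>\<^sup>+ x. ennreal (\<bar>u x\<bar> powr p) \<partial>lborel) (1 / p)"

definition sobolev_norm :: "real \<Rightarrow> real \<Rightarrow> (real ^ 'n \<Rightarrow> real) \<Rightarrow> ennreal" where
  "sobolev_norm s p u =
     ennpowr (ennpowr (lp_norm p u) p + ennpowr (gagliardo_seminorm s p u) p) (1 / p)"

text \<open>
  \<open>m\<close> times continuously differentiable: continuous, resp. differentiable with all
  directional derivatives of class \<open>m - 1\<close>.
\<close>

primrec cont_diff :: "nat \<Rightarrow> (real ^ 'n \<Rightarrow> real) \<Rightarrow> bool" where
  "cont_diff 0 f \<longleftrightarrow> continuous_on UNIV f"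
| "cont_diff (Suc m) f \<longleftrightarrow>
     (\<forall>x. f differentiable at x) \<and> (\<forall>v. cont_diff m (\<lambda>x. frechet_derivative f (at x) v))"

text \<open>
  Elements are functions on the whole space (the extension by zero is built in):
  the support is compact and contained in \<open>\<Omega>\<close>.
\<close>

definition test_functions :: "(real ^ 'n) set \<Rightarrow> (real ^ 'n \<Rightarrow> real) set" where
  "test_functions \<Omega> =
     {\<phi>. (\<forall>m. cont_diff m \<phi>) \<and> compact (closure (support_on UNIV \<phi>)) \<and> closure (support_on UNIV \<phi>) \<subseteq> \<Omega>}"

text \<open>
  Elements of the function spaces are Borel representatives of almost-everywhere classes
  (every Lebesgue measurable function agrees almost everywhere with a Borel one).
  Accordingly, the zero element is the class of functions vanishing almost everywhere.
\<close>

definition sobolev_space :: "real \<Rightarrow> real \<Rightarrow> (real ^ 'n \<Rightarrow> real) set" where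
  "sobolev_space s p = {u \<in> borel_measurable lborel. sobolev_norm s p u < \<infinity>}"

definition sobolev_space0 :: "real \<Rightarrow> real \<Rightarrow> (real ^ 'n) set \<Rightarrow> (real ^ 'n \<Rightarrow> real) set" where
  "sobolev_space0 s p \<Omega> =
     {u \<in> sobolev_space s p. \<forall>\<epsilon>>0. \<exists>\<phi>\<in>test_functions \<Omega>. sobolev_norm s p (\<lambda>x. u x - \<phi> x) < ennreal \<epsilon>}"

definition trunc_exp :: "nat \<Rightarrow> real \<Rightarrow> real" where
  "trunc_exp k x = exp x - (\<Sum>j<k. x ^ j / fact j)"

definition sphere_area :: "nat \<Rightarrow> real" where
  "sphere_area n = real n * pi powr (real n / 2) / Gamma (1 + real n / 2)"

text \<open>The exponent \<open>p\<close> in the constant is determined by \<open>s p = n\<close>.\<close>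

definition gamma_const :: "real \<Rightarrow> nat \<Rightarrow> real" where
  "gamma_const s n = (let p = real n / s in
     2 * (sphere_area n)\<^sup>2 * Gamma (p + 1) / fact n *
       (\<Sum>k. fact (n + k - 1) / (fact k * real (n + 2 * k) powr p)))"

definition alpha_star :: "real \<Rightarrow> nat \<Rightarrow> real" where
  "alpha_star s n = real n * gamma_const s n powr (s / (real n - s))"

end

theory Submission
  imports Defs
begin

text \<open>
  If (i) holds, then \<open>\<Psi>\<^sub>k t \<ge> t\<^sup>k / k!\<close> bounds \<open>\<integral> |u|\<^bsup>kp/(p-1)\<^esup>\<close> for all \<open>u\<close> with seminorm 1, and (ii)
  follows by homogeneity.

  For the converse it suffices to find some small \<open>\<alpha>\<close>, so no sharp inequality is needed. Let \<open>g x\<close> be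
  the inner integral of the Gagliardo energy at \<open>x\<close> and let \<open>a\<^sub>j\<close> be the mean of \<open>u\<close> over the dyadic
  shell of radius about \<open>2\<^bsup>-j\<^esup>\<close> around \<open>x\<close>. By Jensen's inequality \<open>|u x - a\<^sub>m|\<^sup>p\<close> is at most a
  constant times \<open>2\<^bsup>-mn\<^esup> g x\<close>; since the shells are disjoint, \<open>\<Sum>\<^sub>j |a\<^sub>j - a\<^sub>j\<^sub>+\<^sub>1|\<^sup>p\<close> is bounded by the
  energy, hence \<open>|a\<^sub>0 - a\<^sub>m|\<close> by a constant times \<open>m\<^bsup>1-1/p\<^esup>\<close>; and \<open>|a\<^sub>0|\<close> is bounded by the
  \<open>L\<^sup>q\<close> norm, \<open>q = kp/(p-1)\<close>, which (ii) controls. Choosing \<open>2\<^sup>m\<close> comparable to \<open>max 1 (g x)\<close> gives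
  \<open>|u x|\<^bsup>p/(p-1)\<^esup> \<le> D (1 + m)\<close>. For small \<open>\<alpha>\<close> this yields \<open>\<Psi>\<^sub>k (\<alpha> |u x|\<^bsup>p/(p-1)\<^esup>) \<le> 2 |u x|\<^sup>q + 2 g x\<close>,
  which is integrated.
\<close>

section \<open>Convexity of powers: tangent lines and Jensen's inequality\<close>

text \<open>The graph of \<open>t powr p\<close> lies above its tangent at \<open>M\<close>; this is
  Young's inequality for the exponents \<open>p\<close> and \<open>p / (p - 1)\<close>. The terms
  are arranged to be nonnegative, so that the inequality can be integrated in
  \<open>ennreal\<close>.\<close>

lemma powr_tangent_le:
  fixes p t M :: real
  assumes "1 \<le> p" "0 \<le> t" "0 \<le> M"
  shows "p * M powr (p - 1) * t \<le> t powr p + (p - 1) * M powr p"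
proof (cases "p = 1 \<or> t = 0 \<or> M = 0")
  case True
  then show ?thesis using assms by auto
next
  case False
  then have "p > 1" "t > 0" "M > 0" using assms by auto
  have "t * M powr (p - 1) \<le> t powr p / p + (M powr (p - 1)) powr (p / (p - 1)) / (p / (p - 1))"
    using \<open>p > 1\<close> \<open>t > 0\<close> by (intro Youngs_inequality) (auto simp: field_simps)
  also have "(M powr (p - 1)) powr (p / (p - 1)) = M powr p"
    using \<open>p > 1\<close> by (simp add: powr_powr)
  finally show ?thesis using \<open>p > 1\<close> by (simp add: field_simps)
qed

text \<open>The end of each Jensen argument: the left side of the assumption is
  \<open>p * w * M powr p\<close>, so cancelling \<open>(p - 1) * w * M powr p\<close> leaves the
  claim. Here \<open>w\<close> is the total weight and \<open>M\<close> the point of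
  tangency.\<close>

lemma powr_tangent_cancel:
  fixes p M L S w :: real
  assumes "1 \<le> p" "0 \<le> M" "0 \<le> S" "p * M powr (p - 1) * (w * M) \<le> S + (p - 1) * M powr p * w"
  shows "w * M powr p \<le> S"
proof (cases "M = 0")
  case False
  then have "M powr p = M powr (p - 1) * M"
    using assms powr_mult_base[of M "p - 1"] by (simp add: mult.commute)
  then show ?thesis using assms by (simp add: algebra_simps)
qed (use assms in auto)

text \<open>Tangents at the mean \<open>M\<close>, summed. This turns control of the p-th powers of
  increments into control of their sum.\<close>

lemma sum_powr_le:
  fixes d :: "nat \<Rightarrow> real"
  assumes "1 \<le> p" "\<And>j. 0 \<le> d j"
  shows "(\<Sum>j<m. d j) powr p \<le> real m powr (p - 1) * (\<Sum>j<m. d j powr p)"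
proof (cases "m = 0")
  case False
  define M where "M = (\<Sum>j<m. d j) / real m"
  have M: "0 \<le> M" using assms by (auto simp: M_def intro!: divide_nonneg_nonneg sum_nonneg)
  have "(\<Sum>j<m. p * M powr (p - 1) * d j) \<le> (\<Sum>j<m. d j powr p + (p - 1) * M powr p)"
    using assms M by (intro sum_mono powr_tangent_le) auto
  moreover have "(\<Sum>j<m. d j) = real m * M" using False by (simp add: M_def)
  moreover have "(\<Sum>j<m. p * M powr (p - 1) * d j) = p * M powr (p - 1) * (\<Sum>j<m. d j)"
    by (simp add: sum_distrib_left)
  ultimately have "p * M powr (p - 1) * (real m * M) \<le> (\<Sum>j<m. d j powr p) + (p - 1) * M powr p * real m"
    by (simp add: sum.distrib mult_ac)
  then have "real m * M powr p \<le> (\<Sum>j<m. d j powr p)"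
    using assms M by (intro powr_tangent_cancel) (auto intro!: sum_nonneg)
  moreover have "(\<Sum>j<m. d j) powr p = real m powr (p - 1) * (real m * M powr p)"
    using False M \<open>(\<Sum>j<m. d j) = real m * M\<close> powr_mult_base[of "real m" "p - 1"]
    by (simp add: powr_mult algebra_simps)
  ultimately show ?thesis by (simp add: mult_left_mono)
qed auto

text \<open>Jensen's inequality for a probability measure, from the tangent at \<open>R\<close>.
  This \<open>R\<close> is only bounded by the mean of \<open>|c - u|\<close>, which suffices
  because the slope of the tangent is nonnegative.\<close>

lemma mean_powr_le:
  fixes u :: "'a \<Rightarrow> real"
  assumes M: "emeasure M (space M) = 1" and u: "integrable M u" and p: "1 \<le> p"
  shows "ennreal (\<bar>c - (\<integral>z. u z \<partial>M)\<bar> powr p) \<le> (\<integral>\<^sup>+ z. ennreal (\<bar>c - u z\<bar> powr p) \<partial>M)"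
    (is "_ \<le> ?I")
proof (cases "?I = \<infinity>")
  case False
  then obtain S where S: "0 \<le> S" "?I = ennreal S" by (cases ?I) auto
  interpret finite_measure M by standard (use M in simp)
  have [measurable]: "u \<in> borel_measurable M" using u by auto
  define R where "R = \<bar>c - (\<integral>z. u z \<partial>M)\<bar>"
  have [simp]: "measure M (space M) = 1" using M by (simp add: measure_def)
  have "c - (\<integral>z. u z \<partial>M) = (\<integral>z. c - u z \<partial>M)" using u by simp
  then have R: "ennreal R \<le> (\<integral>\<^sup>+ z. ennreal \<bar>c - u z\<bar> \<partial>M)"
    using integral_norm_bound_ennreal[of M "\<lambda>z. c - u z"] u by (simp add: R_def)
  have "ennreal (p * R powr (p - 1) * R) = ennreal (p * R powr (p - 1)) * ennreal R"
    using p by (simp add: ennreal_mult R_def)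
  also have "\<dots> \<le> ennreal (p * R powr (p - 1)) * (\<integral>\<^sup>+ z. ennreal \<bar>c - u z\<bar> \<partial>M)"
    by (intro mult_left_mono R) auto
  also have "\<dots> = (\<integral>\<^sup>+ z. ennreal (p * R powr (p - 1) * \<bar>c - u z\<bar>) \<partial>M)"
    using p by (simp add: ennreal_mult nn_integral_cmult)
  also have "\<dots> \<le> (\<integral>\<^sup>+ z. ennreal (\<bar>c - u z\<bar> powr p) + ennreal ((p - 1) * R powr p) \<partial>M)"
    using p powr_tangent_le[OF p, of "\<bar>c - u _\<bar>" R]
    by (intro nn_integral_mono) (simp add: R_def ennreal_leI flip: ennreal_plus)
  also have "\<dots> = ennreal (S + (p - 1) * R powr p)"
    using S p M by (simp add: nn_integral_add ennreal_plus)
  finally have "p * R powr (p - 1) * R \<le> S + (p - 1) * R powr p"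
    using S p by (subst (asm) ennreal_le_iff) auto
  then have "1 * R powr p \<le> S"
    using S p by (intro powr_tangent_cancel) (auto simp: R_def)
  then show ?thesis using S by (simp add: R_def)
qed auto

section \<open>Dyadic shells and averages over them\<close>

lemma nn_integral_uniform_measure_le:
  fixes f :: "'a \<Rightarrow> ennreal"
  assumes "f \<in> borel_measurable M" "A \<in> sets M" "0 < b" "ennreal b \<le> emeasure M A"
  shows "(\<integral>\<^sup>+ z. f z \<partial>uniform_measure M A) \<le> ennreal (1 / b) * (\<integral>\<^sup>+ z\<in>A. f z \<partial>M)"
proof -
  have "(\<integral>\<^sup>+ z. f z \<partial>uniform_measure M A) = (\<integral>\<^sup>+ z\<in>A. f z \<partial>M) / emeasure M A"
    using assms by (intro nn_integral_uniform_measure)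
  also have "\<dots> \<le> ennreal (1 / b) * (\<integral>\<^sup>+ z\<in>A. f z \<partial>M)"
  proof (rule divide_le_posI_ennreal)
    show "0 < emeasure M A" using assms by (auto intro: less_le_trans[of _ "ennreal b"])
    have "1 = ennreal (1 / b) * ennreal b" using assms by (simp flip: ennreal_mult)
    also have "\<dots> \<le> ennreal (1 / b) * emeasure M A" by (intro mult_left_mono assms) auto
    finally have "1 * (\<integral>\<^sup>+ z\<in>A. f z \<partial>M) \<le> ennreal (1 / b) * emeasure M A * (\<integral>\<^sup>+ z\<in>A. f z \<partial>M)"
      by (intro mult_right_mono) auto
    then show "(\<integral>\<^sup>+ z\<in>A. f z \<partial>M) \<le> emeasure M A * (ennreal (1 / b) * (\<integral>\<^sup>+ z\<in>A. f z \<partial>M))"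
      by (simp add: mult_ac)
  qed
  finally show ?thesis .
qed

text \<open>A shell contains its inner sphere but not its outer one, so the shells around
  \<open>x\<close> are pairwise disjoint and fill the punctured unit ball.\<close>

definition shell :: "'a::euclidean_space \<Rightarrow> nat \<Rightarrow> 'a set" where
  "shell x j = ball x ((1/2) ^ j) - ball x ((1/2) ^ Suc j)"

lemma sets_shell [measurable]: "shell x j \<in> sets borel"
  by (simp add: shell_def)

lemma emeasure_shell_finite: "emeasure lborel (shell x j) < \<infinity>"
proof -
  have "emeasure lborel (shell x j) \<le> emeasure lborel (ball x ((1/2) ^ j))"
    by (intro emeasure_mono) (auto simp: shell_def)
  then show ?thesis using emeasure_ball[of "(1/2)^j" x] by (auto simp: order_le_less_trans)
qed

text \<open>With \<open>W\<close> the volume of the unit ball and \<open>n\<close> the dimension,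
  the measure is \<open>W * (1 - 2^(-n)) * 2^(-n j)\<close>, and \<open>n \<ge> 1\<close> makes the
  middle factor at least 1/2.\<close>

lemma emeasure_shell_ge:
  fixes x :: "'a::euclidean_space"
  shows "ennreal (unit_ball_vol DIM('a) / 2 * (1/2) ^ (DIM('a) * j)) \<le> emeasure lborel (shell x j)"
proof -
  let ?W = "unit_ball_vol DIM('a)" and ?n = "DIM('a)"
  have sub: "ball x ((1/2) ^ Suc j) \<subseteq> ball x ((1/2) ^ j)"
    by (rule subset_ball) simp
  have "emeasure lborel (shell x j) =
      emeasure lborel (ball x ((1/2) ^ j)) - emeasure lborel (ball x ((1/2) ^ Suc j))"
    unfolding shell_def by (rule emeasure_Diff) (use sub in \<open>auto simp: emeasure_ball\<close>)
  also have "\<dots> = ennreal (?W * ((1/2) ^ j) ^ ?n - ?W * ((1/2) ^ Suc j) ^ ?n)"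
    by (simp only: emeasure_ball zero_le_power zero_le_divide_1_iff zero_le_numeral)
      (simp add: ennreal_minus)
  also have "?W * ((1/2) ^ j) ^ ?n - ?W * ((1/2) ^ Suc j) ^ ?n
      = ?W * (1 - (1/2) ^ ?n) * (1/2) ^ (?n * j)"
    by (simp add: power_divide power_mult[symmetric] field_simps)
  also have "ennreal \<dots> \<ge> ennreal (?W / 2 * (1/2) ^ (?n * j))"
  proof (intro ennreal_leI mult_right_mono)
    have "(1/2::real) ^ ?n \<le> (1/2) ^ 1"
      by (intro power_decreasing) (auto simp: Suc_leI)
    then have "?W * (1/2) \<le> ?W * (1 - (1/2) ^ ?n)" by (intro mult_left_mono) auto
    then show "?W / 2 \<le> ?W * (1 - (1/2) ^ ?n)" by simp
  qed auto
  finally show ?thesis .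
qed

definition shell_mean :: "('a::euclidean_space \<Rightarrow> real) \<Rightarrow> 'a \<Rightarrow> nat \<Rightarrow> real" where
  "shell_mean u x j = (\<integral>z. u z \<partial>uniform_measure lborel (shell x j))"

text \<open>The kernel exponent \<open>n + s p\<close> is \<open>2 n\<close> when
  \<open>s p = n\<close>, which is why \<open>s\<close> is absent.\<close>

definition gagliardo_density :: "real \<Rightarrow> ('a::euclidean_space \<Rightarrow> real) \<Rightarrow> 'a \<Rightarrow> ennreal" where
  "gagliardo_density p u y = (\<integral>\<^sup>+ x. ennreal (\<bar>u x - u y\<bar> powr p / norm (x - y) ^ (2 * DIM('a))) \<partial>lborel)"

lemma gagliardo_density_measurable [measurable]:
  assumes [measurable]: "u \<in> borel_measurable borel"
  shows "gagliardo_density p u \<in> borel_measurable borel"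
  unfolding gagliardo_density_def by measurable

lemma emeasure_shell_pos:
  fixes x :: "'a::euclidean_space"
  shows "emeasure lborel (shell x j) \<noteq> 0"
proof -
  have "0 < ennreal (unit_ball_vol DIM('a) / 2 * (1/2) ^ (DIM('a) * j))" by simp
  then show ?thesis using emeasure_shell_ge[of j x] by (metis not_le)
qed

lemma emeasure_uniform_shell:
  "emeasure (uniform_measure lborel (shell x j)) (space (uniform_measure lborel (shell x j))) = 1"
  using emeasure_shell_pos[of x j] emeasure_shell_finite[of x j]
  by (simp add: emeasure_uniform_measure_1)

text \<open>On a probability space \<open>L^q\<close> lies in \<open>L^1\<close>, by
  \<open>t \<le> 1 + t powr q\<close>. Without integrability the Bochner integral in
  \<open>shell_mean\<close> would be the default value 0 and Jensen's inequality would not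
  apply.\<close>

lemma integrable_uniform_shell:
  fixes u :: "'a::euclidean_space \<Rightarrow> real"
  assumes [measurable]: "u \<in> borel_measurable borel" and q: "1 \<le> q"
    and fin: "(\<integral>\<^sup>+ x. ennreal (\<bar>u x\<bar> powr q) \<partial>lborel) < \<infinity>"
  shows "integrable (uniform_measure lborel (shell x j)) u"
proof (rule integrableI_bounded)
  let ?U = "uniform_measure lborel (shell x j)"
  have "t \<le> 1 + t powr q" if "0 \<le> t" for t :: real
    using powr_mono[of 1 q t] q that powr_one[of t] by (cases "t \<le> 1") (auto simp: add_increasing2)
  then have "(\<integral>\<^sup>+ z. norm (u z) \<partial>?U) \<le> (\<integral>\<^sup>+ z. 1 + ennreal (\<bar>u z\<bar> powr q) \<partial>?U)"
    by (intro nn_integral_mono) (auto simp flip: ennreal_plus ennreal_1 intro!: ennreal_leI)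
  also have "\<dots> = 1 + (\<integral>\<^sup>+ z. ennreal (\<bar>u z\<bar> powr q) \<partial>?U)"
    using emeasure_uniform_shell[of x j] by (subst nn_integral_add) auto
  also have "\<dots> < \<infinity>"
  proof -
    have "(\<integral>\<^sup>+ z\<in>shell x j. ennreal (\<bar>u z\<bar> powr q) \<partial>lborel) \<le> (\<integral>\<^sup>+ x. ennreal (\<bar>u x\<bar> powr q) \<partial>lborel)"
      by (intro nn_integral_mono) (auto simp: indicator_def)
    then show ?thesis
      using fin emeasure_shell_pos[of x j]
      by (subst nn_integral_uniform_measure)
        (auto simp: ennreal_divide_eq_top_iff less_top[symmetric] top_unique)
  qed
  finally show "(\<integral>\<^sup>+ z. norm (u z) \<partial>?U) < \<infinity>" .
qed measurable

lemma norm_diff_le_of_shell: "z \<in> shell x j \<Longrightarrow> norm (z - x) \<le> (1/2) ^ j"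
  by (simp add: shell_def dist_norm norm_minus_commute)

lemma disjoint_family_shell: "disjoint_family (shell x)"
proof -
  have *: "z \<notin> shell x j" if "i < j" "z \<in> shell x i" for i j z
  proof -
    have "(1/2::real) ^ j \<le> (1/2) ^ Suc i" using that by (intro power_decreasing) auto
    then show ?thesis using that by (auto simp: shell_def)
  qed
  then have "shell x i \<inter> shell x j = {}" if "i \<noteq> j" for i j
    using that linorder_less_linear[of i j] by blast
  then show ?thesis by (auto simp: disjoint_family_on_def)
qed

section \<open>Jensen estimates for shell means\<close>

text \<open>Jensen's inequality with \<open>c = 0\<close>; this anchors the chain of means at unit
  scale.\<close>

lemma abs_shell_mean_powr_le:
  fixes u :: "'a::euclidean_space \<Rightarrow> real"
  assumes [measurable]: "u \<in> borel_measurable borel" and q: "1 \<le> q"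
    and fin: "(\<integral>\<^sup>+ x. ennreal (\<bar>u x\<bar> powr q) \<partial>lborel) < \<infinity>"
  shows "ennreal (\<bar>shell_mean u x 0\<bar> powr q)
    \<le> ennreal (2 / unit_ball_vol DIM('a)) * (\<integral>\<^sup>+ x. ennreal (\<bar>u x\<bar> powr q) \<partial>lborel)"
proof -
  have "ennreal (\<bar>0 - shell_mean u x 0\<bar> powr q)
      \<le> (\<integral>\<^sup>+ z. ennreal (\<bar>0 - u z\<bar> powr q) \<partial>uniform_measure lborel (shell x 0))"
    unfolding shell_mean_def
    by (intro mean_powr_le emeasure_uniform_shell integrable_uniform_shell[OF _ q fin] q assms)
  also have "\<dots> \<le> ennreal (1 / (unit_ball_vol DIM('a) / 2))
      * (\<integral>\<^sup>+ z\<in>shell x 0. ennreal (\<bar>0 - u z\<bar> powr q) \<partial>lborel)"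
    using emeasure_shell_ge[of 0 x] by (intro nn_integral_uniform_measure_le) auto
  also have "\<dots> \<le> ennreal (1 / (unit_ball_vol DIM('a) / 2)) * (\<integral>\<^sup>+ x. ennreal (\<bar>u x\<bar> powr q) \<partial>lborel)"
    by (intro mult_left_mono nn_integral_mono) (auto simp: indicator_def)
  finally show ?thesis by simp
qed

text \<open>Jensen's inequality with \<open>c = u y\<close>. On the shell the kernel weight is at
  least \<open>R^(-2n)\<close>, so inserting it costs the factor \<open>R^(2n)\<close>; the integral
  is then enlarged to the whole space. The point \<open>y\<close> need not be the centre
  \<open>x\<close>.\<close>

lemma diff_shell_mean_powr_le:
  fixes u :: "'a::euclidean_space \<Rightarrow> real"
  assumes [measurable]: "u \<in> borel_measurable borel" and q: "1 \<le> q" and p: "1 \<le> p"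
    and fin: "(\<integral>\<^sup>+ x. ennreal (\<bar>u x\<bar> powr q) \<partial>lborel) < \<infinity>"
    and R: "\<And>z. z \<in> shell x j \<Longrightarrow> norm (z - y) \<le> R" "0 \<le> R"
  shows "ennreal (\<bar>u y - shell_mean u x j\<bar> powr p)
    \<le> ennreal (2 / unit_ball_vol DIM('a) * 2 ^ (DIM('a) * j) * R ^ (2 * DIM('a))) * gagliardo_density p u y"
proof -
  let ?W = "unit_ball_vol DIM('a)" and ?n = "DIM('a)"
  let ?k = "\<lambda>z. ennreal (\<bar>u z - u y\<bar> powr p / norm (z - y) ^ (2 * ?n))"
  have "ennreal (\<bar>u y - shell_mean u x j\<bar> powr p)
      \<le> (\<integral>\<^sup>+ z. ennreal (\<bar>u y - u z\<bar> powr p) \<partial>uniform_measure lborel (shell x j))"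
    unfolding shell_mean_def
    by (intro mean_powr_le emeasure_uniform_shell integrable_uniform_shell[OF _ q fin] p assms)
  also have "\<dots> \<le> ennreal (1 / (?W / 2 * (1/2) ^ (?n * j)))
      * (\<integral>\<^sup>+ z\<in>shell x j. ennreal (\<bar>u y - u z\<bar> powr p) \<partial>lborel)"
    using emeasure_shell_ge[of j x] by (intro nn_integral_uniform_measure_le) auto
  also have "1 / (?W / 2 * (1/2) ^ (?n * j)) = 2 / ?W * 2 ^ (?n * j)"
    by (simp add: power_divide)
  also have "(\<integral>\<^sup>+ z\<in>shell x j. ennreal (\<bar>u y - u z\<bar> powr p) \<partial>lborel)
      \<le> (\<integral>\<^sup>+ z. ennreal (R ^ (2 * ?n)) * ?k z \<partial>lborel)"
  proof (intro nn_integral_mono)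
    fix z
    show "ennreal (\<bar>u y - u z\<bar> powr p) * indicator (shell x j) z \<le> ennreal (R ^ (2 * ?n)) * ?k z"
    \<comment> \<open>At \<open>z = y\<close> the kernel is 0 by division by zero, but
      \<open>u y - u z\<close> vanishes there too.\<close>
    proof (cases "z \<in> shell x j \<and> z \<noteq> y")
      case True
      then have "norm (z - y) ^ (2 * ?n) \<le> R ^ (2 * ?n)" by (intro power_mono R) auto
      moreover have "0 < norm (z - y) ^ (2 * ?n)" using True by simp
      ultimately have "1 \<le> R ^ (2 * ?n) / norm (z - y) ^ (2 * ?n)"
        by (simp only: le_divide_eq_1_pos)
      then have "1 * \<bar>u z - u y\<bar> powr p \<le> R ^ (2 * ?n) / norm (z - y) ^ (2 * ?n) * \<bar>u z - u y\<bar> powr p"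
        by (intro mult_right_mono) auto
      then show ?thesis
        using True R by (simp add: abs_minus_commute ennreal_leI flip: ennreal_mult)
    qed (auto simp: indicator_def)
  qed
  also have "\<dots> = ennreal (R ^ (2 * ?n)) * gagliardo_density p u y"
    unfolding gagliardo_density_def by (intro nn_integral_cmult) measurable
  finally have "ennreal (\<bar>u y - shell_mean u x j\<bar> powr p)
      \<le> ennreal (2 / ?W * 2 ^ (?n * j)) * (ennreal (R ^ (2 * ?n)) * gagliardo_density p u y)"
    by (simp add: mult_left_mono)
  then show ?thesis using R by (subst ennreal_mult) (auto simp: mult.assoc)
qed

lemma two_power_half_power: "2 ^ i * (1/2) ^ i = (1::real)"
  by (simp flip: power_mult_distrib)

lemma half_power_square: "((1/2) ^ j) ^ (2 * n) = ((1/2) ^ (n * j) * (1/2) ^ (n * j) :: real)"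
  unfolding power_mult[symmetric] power_add[symmetric]
  by (rule arg_cong[where f = "(^) (1/2)"]) simp

text \<open>The case \<open>y = x\<close> and \<open>R = 2^(-m)\<close>: the factors
  \<open>2^(n m)\<close> and \<open>2^(-2 n m)\<close> combine to \<open>2^(-n m)\<close>.\<close>

lemma diff_shell_mean_self_powr_le:
  fixes u :: "'a::euclidean_space \<Rightarrow> real"
  assumes [measurable]: "u \<in> borel_measurable borel" and q: "1 \<le> q" and p: "1 \<le> p"
    and fin: "(\<integral>\<^sup>+ x. ennreal (\<bar>u x\<bar> powr q) \<partial>lborel) < \<infinity>"
  shows "ennreal (\<bar>u x - shell_mean u x m\<bar> powr p)
    \<le> ennreal (2 / unit_ball_vol DIM('a) * (1/2) ^ (DIM('a) * m)) * gagliardo_density p u x"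
proof -
  have "ennreal (\<bar>u x - shell_mean u x m\<bar> powr p)
    \<le> ennreal (2 / unit_ball_vol DIM('a) * 2 ^ (DIM('a) * m) * ((1/2) ^ m) ^ (2 * DIM('a))) * gagliardo_density p u x"
    by (intro diff_shell_mean_powr_le[OF _ q p fin] norm_diff_le_of_shell assms) auto
  also have "2 / unit_ball_vol DIM('a) * 2 ^ (DIM('a) * m) * ((1/2) ^ m) ^ (2 * DIM('a))
      = 2 / unit_ball_vol DIM('a) * (1/2) ^ (DIM('a) * m)"
    unfolding half_power_square using two_power_half_power[of "DIM('a) * m"]
    by (simp add: mult.assoc)
  finally show ?thesis .
qed

text \<open>The distance from \<open>u y\<close> to the mean over shell \<open>j + 1\<close> is
  averaged over \<open>y\<close> in shell \<open>j\<close>. Only the density on shell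
  \<open>j\<close> enters, so that the estimates for different \<open>j\<close> can be
  added.\<close>

lemma diff_shell_means_powr_le:
  fixes u :: "'a::euclidean_space \<Rightarrow> real"
  assumes [measurable]: "u \<in> borel_measurable borel" and q: "1 \<le> q" and p: "1 \<le> p"
    and fin: "(\<integral>\<^sup>+ x. ennreal (\<bar>u x\<bar> powr q) \<partial>lborel) < \<infinity>"
  shows "ennreal (\<bar>shell_mean u x j - shell_mean u x (Suc j)\<bar> powr p)
    \<le> ennreal ((2 / unit_ball_vol DIM('a))\<^sup>2 * 8 ^ DIM('a)) * (\<integral>\<^sup>+ y\<in>shell x j. gagliardo_density p u y \<partial>lborel)"
proof -
  let ?W = "unit_ball_vol DIM('a)" and ?n = "DIM('a)"
  let ?c = "2 / ?W * 2 ^ (?n * Suc j) * (2 * (1/2) ^ j) ^ (2 * ?n)"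
  have "ennreal (\<bar>shell_mean u x (Suc j) - shell_mean u x j\<bar> powr p)
      \<le> (\<integral>\<^sup>+ y. ennreal (\<bar>shell_mean u x (Suc j) - u y\<bar> powr p) \<partial>uniform_measure lborel (shell x j))"
    unfolding shell_mean_def[of u x j]
    by (intro mean_powr_le emeasure_uniform_shell integrable_uniform_shell[OF _ q fin] p assms)
  also have "\<dots> \<le> ennreal (1 / (?W / 2 * (1/2) ^ (?n * j)))
      * (\<integral>\<^sup>+ y\<in>shell x j. ennreal (\<bar>shell_mean u x (Suc j) - u y\<bar> powr p) \<partial>lborel)"
    using emeasure_shell_ge[of j x] by (intro nn_integral_uniform_measure_le) auto
  also have "(\<integral>\<^sup>+ y\<in>shell x j. ennreal (\<bar>shell_mean u x (Suc j) - u y\<bar> powr p) \<partial>lborel)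
      \<le> (\<integral>\<^sup>+ y. ennreal ?c * (gagliardo_density p u y * indicator (shell x j) y) \<partial>lborel)"
  proof (intro nn_integral_mono)
    fix y
    show "ennreal (\<bar>shell_mean u x (Suc j) - u y\<bar> powr p) * indicator (shell x j) y
        \<le> ennreal ?c * (gagliardo_density p u y * indicator (shell x j) y)"
    proof (cases "y \<in> shell x j")
      case True
      have "norm (z - y) \<le> 2 * (1/2) ^ j" if "z \<in> shell x (Suc j)" for z
      proof -
        have "norm (z - x) \<le> (1/2) ^ j"
          by (rule order_trans[OF norm_diff_le_of_shell[OF that]]) simp
        then show ?thesis
          using norm_diff_le_of_shell[OF True] norm_triangle_ineq4[of "z - x" "y - x"] by simp
      qed
      then have "ennreal (\<bar>u y - shell_mean u x (Suc j)\<bar> powr p) \<le> ennreal ?c * gagliardo_density p u y"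
        by (intro diff_shell_mean_powr_le[OF _ q p fin] assms) auto
      then show ?thesis using True by (simp add: abs_minus_commute)
    qed auto
  qed
  also have "\<dots> = ennreal ?c * (\<integral>\<^sup>+ y\<in>shell x j. gagliardo_density p u y \<partial>lborel)"
    by (intro nn_integral_cmult) measurable
  finally have "ennreal (\<bar>shell_mean u x (Suc j) - shell_mean u x j\<bar> powr p)
      \<le> ennreal (1 / (?W / 2 * (1/2) ^ (?n * j)) * ?c) * (\<integral>\<^sup>+ y\<in>shell x j. gagliardo_density p u y \<partial>lborel)"
    by (subst ennreal_mult) (auto simp: mult.assoc mult_left_mono)
  \<comment> \<open>All powers of \<open>2^j\<close> cancel, which reflects the scale invariance of
    the energy for \<open>s p = n\<close>. In the computation \<open>a\<close> and \<open>b\<close>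
    stand for \<open>2^(n j)\<close> and its inverse.\<close>
  also have "1 / (?W / 2 * (1/2) ^ (?n * j)) * ?c = (2 / ?W)\<^sup>2 * 8 ^ ?n"
  proof -
    have "1 / (w / 2 * b) * (2 / w * (2 ^ ?n * a) * (4 ^ ?n * (b * b))) = (2 / w)\<^sup>2 * 8 ^ ?n"
      if "a * b = 1" "w \<noteq> 0" for a b w :: real
    proof -
      have "b \<noteq> 0" using that by auto
      then have "1 / (w / 2 * b) * (2 / w * (2 ^ ?n * a) * (4 ^ ?n * (b * b))) = (2 / w)\<^sup>2 * (2 ^ ?n * 4 ^ ?n) * (a * b)"
        using that(2) by (simp add: power2_eq_square)
      then show ?thesis using that(1) by (simp flip: power_mult_distrib)
    qed
    moreover have "?W \<noteq> 0" using unit_ball_vol_pos[of "real ?n"] by linarith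
    ultimately have *: "1 / (?W / 2 * (1/2) ^ (?n * j))
        * (2 / ?W * (2 ^ ?n * 2 ^ (?n * j)) * (4 ^ ?n * ((1/2) ^ (?n * j) * (1/2) ^ (?n * j)))) = (2 / ?W)\<^sup>2 * 8 ^ ?n"
      using two_power_half_power by blast
    have sq: "(2 * (1/2) ^ j) ^ (2 * ?n) = (4 ^ ?n * ((1/2) ^ (?n * j) * (1/2) ^ (?n * j)) :: real)"
      unfolding power_mult_distrib[of 2] half_power_square by (simp add: power_mult)
    show ?thesis unfolding sq mult_Suc_right power_add by (rule *)
  qed
  finally show ?thesis by (simp add: abs_minus_commute)
qed

text \<open>Disjointness of the shells charges each part of the energy at most once, so the bound
  does not depend on \<open>m\<close>.\<close>

lemma sum_diff_shell_means_powr_le: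
  fixes u :: "'a::euclidean_space \<Rightarrow> real"
  assumes [measurable]: "u \<in> borel_measurable borel" and q: "1 \<le> q" and p: "1 \<le> p"
    and fin: "(\<integral>\<^sup>+ x. ennreal (\<bar>u x\<bar> powr q) \<partial>lborel) < \<infinity>"
  shows "ennreal (\<Sum>j<m. \<bar>shell_mean u x j - shell_mean u x (Suc j)\<bar> powr p)
    \<le> ennreal ((2 / unit_ball_vol DIM('a))\<^sup>2 * 8 ^ DIM('a)) * (\<integral>\<^sup>+ y. gagliardo_density p u y \<partial>lborel)"
proof -
  let ?C = "ennreal ((2 / unit_ball_vol DIM('a))\<^sup>2 * 8 ^ DIM('a))"
  have "ennreal (\<Sum>j<m. \<bar>shell_mean u x j - shell_mean u x (Suc j)\<bar> powr p)
      = (\<Sum>j<m. ennreal (\<bar>shell_mean u x j - shell_mean u x (Suc j)\<bar> powr p))"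
    by (simp add: sum_ennreal)
  also have "\<dots> \<le> (\<Sum>j<m. ?C * (\<integral>\<^sup>+ y\<in>shell x j. gagliardo_density p u y \<partial>lborel))"
    by (intro sum_mono diff_shell_means_powr_le[OF assms])
  also have "\<dots> = ?C * (\<integral>\<^sup>+ y. (\<Sum>j<m. gagliardo_density p u y * indicator (shell x j) y) \<partial>lborel)"
    by (subst nn_integral_sum) (auto simp: sum_distrib_left)
  also have "\<dots> \<le> ?C * (\<integral>\<^sup>+ y. gagliardo_density p u y \<partial>lborel)"
  proof (intro mult_left_mono nn_integral_mono)
    fix y
    have "disjoint_family_on (shell x) {..<m}"
      using disjoint_family_shell by (rule disjoint_family_on_mono[rotated]) simp
    then have "(\<Sum>j<m. indicator (shell x j) y) = (indicator (\<Union>j<m. shell x j) y :: ennreal)"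
      by (simp add: indicator_UN_disjoint)
    then show "(\<Sum>j<m. gagliardo_density p u y * indicator (shell x j) y) \<le> gagliardo_density p u y"
      by (simp add: indicator_def flip: sum_distrib_left)
  qed auto
  finally show ?thesis .
qed

section \<open>Pointwise bound by the logarithm of the Gagliardo density\<close>

lemma le_powr_inverse:
  fixes a b p :: real
  assumes "a powr p \<le> b" "0 \<le> a" "0 < p"
  shows "a \<le> b powr (1 / p)"
  using powr_mono2[of "1/p" "a powr p" b] assms by (simp add: powr_powr)

text \<open>The triangle inequality along \<open>0\<close>, \<open>a_0\<close>, \<open>a_m\<close>,
  \<open>u x\<close>, where \<open>a_j\<close> is the mean over shell \<open>j\<close>; the middle
  step telescopes and \<open>sum_powr_le\<close> applies. The number \<open>m\<close> stays free:
  the second term grows with it, the third decays.\<close>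

lemma abs_le_shell_chain:
  fixes u :: "'a::euclidean_space \<Rightarrow> real"
  defines "W \<equiv> unit_ball_vol DIM('a)"
  assumes u: "u \<in> borel_measurable borel" and q: "1 \<le> q" and p: "1 < p"
    and Q: "(\<integral>\<^sup>+ x. ennreal (\<bar>u x\<bar> powr q) \<partial>lborel) \<le> ennreal Q" "0 \<le> Q"
    and G: "(\<integral>\<^sup>+ y. gagliardo_density p u y \<partial>lborel) \<le> 1"
    and g: "gagliardo_density p u x = ennreal g" "0 \<le> g"
  shows "\<bar>u x\<bar> \<le> (2 / W * Q) powr (1 / q) + ((2 / W)\<^sup>2 * 8 ^ DIM('a)) powr (1 / p) * real m powr (1 - 1 / p)
     + (2 / W * ((1/2) ^ (DIM('a) * m) * g)) powr (1 / p)"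
proof -
  let ?a = "shell_mean u x" and ?C = "(2 / W)\<^sup>2 * 8 ^ DIM('a)"
  have W: "0 < W" by (simp add: W_def)
  have fin: "(\<integral>\<^sup>+ x. ennreal (\<bar>u x\<bar> powr q) \<partial>lborel) < \<infinity>"
    using Q by (auto intro: le_less_trans)
  have "ennreal (\<bar>?a 0\<bar> powr q) \<le> ennreal (2 / W) * ennreal Q"
    using abs_shell_mean_powr_le[OF u q fin, of x] Q unfolding W_def
    by (meson mult_left_mono order_trans zero_le)
  then have "\<bar>?a 0\<bar> powr q \<le> 2 / W * Q"
    using W Q by (simp flip: ennreal_mult)
  then have 1: "\<bar>?a 0\<bar> \<le> (2 / W * Q) powr (1 / q)"
    using q by (intro le_powr_inverse) auto
  have "ennreal (\<Sum>j<m. \<bar>?a j - ?a (Suc j)\<bar> powr p) \<le> ennreal ?C * 1"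
    using sum_diff_shell_means_powr_le[OF u q _ fin, of p x m] p G unfolding W_def
    by (meson mult_left_mono order_trans zero_le less_imp_le)
  then have "(\<Sum>j<m. \<bar>?a j - ?a (Suc j)\<bar> powr p) \<le> ?C" by simp
  then have "real m powr (p - 1) * (\<Sum>j<m. \<bar>?a j - ?a (Suc j)\<bar> powr p) \<le> real m powr (p - 1) * ?C"
    by (intro mult_left_mono) auto
  then have "(\<Sum>j<m. \<bar>?a j - ?a (Suc j)\<bar>) powr p \<le> real m powr (p - 1) * ?C"
    using sum_powr_le[of p "\<lambda>j. \<bar>?a j - ?a (Suc j)\<bar>" m] p by simp
  then have "(\<Sum>j<m. \<bar>?a j - ?a (Suc j)\<bar>) \<le> (real m powr (p - 1) * ?C) powr (1 / p)"
    using p by (intro le_powr_inverse) (auto intro: sum_nonneg)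
  also have "\<dots> = ?C powr (1 / p) * real m powr (1 - 1 / p)"
    using p by (simp add: powr_mult powr_powr diff_divide_distrib)
  finally have 2: "\<bar>?a 0 - ?a m\<bar> \<le> ?C powr (1 / p) * real m powr (1 - 1 / p)"
    using sum_abs[of "\<lambda>j. ?a j - ?a (Suc j)" "{..<m}"] sum_lessThan_telescope'[of ?a m] by simp
  have "ennreal (\<bar>u x - ?a m\<bar> powr p) \<le> ennreal (2 / W * (1/2) ^ (DIM('a) * m)) * ennreal g"
    using diff_shell_mean_self_powr_le[OF u q _ fin, of p x m] p g unfolding W_def by simp
  then have "\<bar>u x - ?a m\<bar> powr p \<le> 2 / W * ((1/2) ^ (DIM('a) * m) * g)"
    using g W by (simp add: mult.assoc flip: ennreal_mult)
  then have 3: "\<bar>u x - ?a m\<bar> \<le> (2 / W * ((1/2) ^ (DIM('a) * m) * g)) powr (1 / p)"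
    using p by (intro le_powr_inverse) auto
  from 1 2 3 show ?thesis by linarith
qed

lemma dyadic_between:
  fixes t :: real
  assumes "1 \<le> t"
  obtains m :: nat where "2 ^ m \<le> t" "t \<le> 2 ^ Suc m"
proof
  let ?m = "nat \<lfloor>log 2 t\<rfloor>"
  have l: "0 \<le> log 2 t" using assms by simp
  then have "real ?m \<le> log 2 t" "log 2 t \<le> real (Suc ?m)" by linarith+
  then show "2 ^ ?m \<le> t" "t \<le> 2 ^ Suc ?m"
    using assms by (simp_all only: le_log_iff log_le_iff powr_realpow)
qed

text \<open>Taking \<open>2^m\<close> comparable to \<open>max 1 g\<close> balances the chain
  estimate: the last term becomes bounded and only the growth of order \<open>1 - 1/p\<close> in
  \<open>m\<close> remains. The constant \<open>D\<close> is uniform in \<open>u\<close> and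
  \<open>x\<close>.\<close>

lemma abs_powr_le_log_gagliardo_density:
  fixes p q Q :: real
  assumes q: "1 \<le> q" and p: "1 < p" and "0 \<le> Q"
  obtains D where "0 < D"
    and "\<And>(u :: 'a::euclidean_space \<Rightarrow> real) x g. \<lbrakk>u \<in> borel_measurable borel;
      (\<integral>\<^sup>+ x. ennreal (\<bar>u x\<bar> powr q) \<partial>lborel) \<le> ennreal Q;
      (\<integral>\<^sup>+ y. gagliardo_density p u y \<partial>lborel) \<le> 1;
      gagliardo_density p u x = ennreal g; 0 \<le> g\<rbrakk>
      \<Longrightarrow> \<exists>m::nat. 2 ^ m \<le> max 1 g \<and> \<bar>u x\<bar> powr (p / (p - 1)) \<le> D * (1 + real m)"
proof
  define W where "W = unit_ball_vol DIM('a)"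
  have W: "0 < W" by (simp add: W_def)
  \<comment> \<open>One summand for each term of the chain; the factor 2 in the last one bounds
    \<open>2^(-n m) * g\<close>.\<close>
  define A where "A = (2 / W * Q) powr (1 / q) + ((2 / W)\<^sup>2 * 8 ^ DIM('a)) powr (1 / p) + (2 / W * 2) powr (1 / p)"
  have "0 < A" using W by (auto simp: A_def intro!: add_nonneg_pos)
  then show "0 < A powr (p / (p - 1))" by simp
  fix u :: "'a::euclidean_space \<Rightarrow> real" and x g
  assume u: "u \<in> borel_measurable borel"
    and Q: "(\<integral>\<^sup>+ x. ennreal (\<bar>u x\<bar> powr q) \<partial>lborel) \<le> ennreal Q"
    and G: "(\<integral>\<^sup>+ y. gagliardo_density p u y \<partial>lborel) \<le> 1"
    and g: "gagliardo_density p u x = ennreal g" "0 \<le> g"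
  obtain m where m: "2 ^ m \<le> max 1 g" "max 1 g \<le> 2 ^ Suc m"
    using dyadic_between[of "max 1 g"] by auto
  let ?t = "(1 + real m) powr (1 - 1 / p)"
  have t: "1 \<le> ?t" using p by (intro ge_one_powr_ge_zero) auto
  have "(1/2) ^ (DIM('a) * m) * g \<le> (1/2) ^ m * 2 ^ Suc m"
    using m g by (intro mult_mono power_decreasing) (auto simp: Suc_leI)
  also have "\<dots> = (2::real)" by (simp add: power_divide)
  finally have "(2 / W * ((1/2) ^ (DIM('a) * m) * g)) powr (1 / p) \<le> (2 / W * 2) powr (1 / p)"
    using W p g by (intro powr_mono2 mult_left_mono) auto
  moreover have "real m powr (1 - 1 / p) \<le> ?t"
    using p by (intro powr_mono2) auto
  ultimately have "\<bar>u x\<bar> \<le> (2 / W * Q) powr (1 / q) * 1 + ((2 / W)\<^sup>2 * 8 ^ DIM('a)) powr (1 / p) * ?t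
      + (2 / W * 2) powr (1 / p) * 1"
    using abs_le_shell_chain[OF u q p Q \<open>0 \<le> Q\<close> G g, of m, folded W_def]
      mult_left_mono[of "real m powr (1 - 1 / p)" ?t "((2 / W)\<^sup>2 * 8 ^ DIM('a)) powr (1 / p)"]
    by simp
  also have "\<dots> \<le> A * ?t"
    unfolding A_def distrib_right using t by (intro add_mono mult_left_mono) auto
  finally have "\<bar>u x\<bar> powr (p / (p - 1)) \<le> (A * ?t) powr (p / (p - 1))"
    using p by (intro powr_mono2) auto
  also have "\<dots> = A powr (p / (p - 1)) * (1 + real m) powr ((1 - 1 / p) * (p / (p - 1)))"
    using \<open>0 < A\<close> by (simp add: powr_mult powr_powr)
  \<comment> \<open>The power \<open>p / (p - 1)\<close> is exactly the one that makes the bound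
    linear in \<open>m\<close>.\<close>
  also have "(1 - 1 / p) * (p / (p - 1)) = 1" using p by (simp add: field_simps)
  finally show "\<exists>m::nat. 2 ^ m \<le> max 1 g \<and> \<bar>u x\<bar> powr (p / (p - 1)) \<le> A powr (p / (p - 1)) * (1 + real m)"
    using m by auto
qed

section \<open>The truncated exponential and an integral bound for small exponents\<close>

lemma trunc_exp_sums: "(\<lambda>j. x ^ (j + k) / fact (j + k)) sums trunc_exp k x"
  using sums_split_initial_segment[OF exp_converges[of x], of k]
  by (simp add: trunc_exp_def scaleR_conv_of_real divide_inverse mult.commute)

lemma trunc_exp_ge:
  assumes "0 \<le> x"
  shows "x ^ k / fact k \<le> trunc_exp k x"
proof -
  have "(\<Sum>j\<in>{0}. x ^ (j + k) / fact (j + k)) \<le> (\<Sum>j. x ^ (j + k) / fact (j + k))"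
    using assms trunc_exp_sums[of x k] by (intro sum_le_suminf) (auto simp: sums_iff)
  then show ?thesis using trunc_exp_sums[of x k] by (simp add: sums_iff)
qed

lemma trunc_exp_le_exp: "0 \<le> x \<Longrightarrow> trunc_exp k x \<le> exp x"
  by (simp add: trunc_exp_def sum_nonneg)

text \<open>Termwise in the tail series, since \<open>fact j \<le> fact (j + k)\<close>. Unlike the
  bound by \<open>exp x\<close>, it keeps the vanishing of order \<open>k\<close> at 0.\<close>

lemma trunc_exp_le:
  assumes "0 \<le> x"
  shows "trunc_exp k x \<le> x ^ k * exp x"
proof (rule sums_le[OF _ trunc_exp_sums])
  show "(\<lambda>j. x ^ k * (x ^ j /\<^sub>R fact j)) sums (x ^ k * exp x)"
    by (intro sums_mult exp_converges)
  fix j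
  have "(fact j :: real) \<le> fact (j + k)" by (intro fact_mono) auto
  then have "x ^ (j + k) / fact (j + k) \<le> x ^ (j + k) / fact j"
    using assms by (intro divide_left_mono) auto
  also have "\<dots> = x ^ k * (x ^ j /\<^sub>R fact j)" by (simp add: power_add divide_inverse)
  finally show "x ^ (j + k) / fact (j + k) \<le> x ^ k * (x ^ j /\<^sub>R fact j)" .
qed

text \<open>The bound is stated for every \<open>\<alpha> \<le> \<beta>\<close>, so that
  \<open>\<alpha>\<close> can afterwards be lowered below the critical constant.\<close>

theorem trudinger_inequality:
  fixes p Q :: real and k :: nat
  defines "q \<equiv> real k * p / (p - 1)"
  assumes p: "1 < p" and k: "1 \<le> k" and Q: "0 \<le> Q"
  obtains \<beta> where "0 < \<beta>"
    and "\<And>\<alpha> (u :: 'a::euclidean_space \<Rightarrow> real). \<lbrakk>0 < \<alpha>; \<alpha> \<le> \<beta>; u \<in> borel_measurable borel;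
      (\<integral>\<^sup>+ x. ennreal (\<bar>u x\<bar> powr q) \<partial>lborel) \<le> ennreal Q;
      (\<integral>\<^sup>+ y. gagliardo_density p u y \<partial>lborel) \<le> 1\<rbrakk>
      \<Longrightarrow> (\<integral>\<^sup>+ x. ennreal (trunc_exp k (\<alpha> * \<bar>u x\<bar> powr (p / (p - 1)))) \<partial>lborel) \<le> 2 * ennreal Q + 2"
proof -
  have "1 * (p - 1) \<le> real k * p" using k p by (intro mult_mono) auto
  then have q: "1 \<le> q" using p by (simp add: q_def)
  obtain D where "0 < D" and D: "\<And>(u :: 'a \<Rightarrow> real) x g. \<lbrakk>u \<in> borel_measurable borel;
      (\<integral>\<^sup>+ x. ennreal (\<bar>u x\<bar> powr q) \<partial>lborel) \<le> ennreal Q;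
      (\<integral>\<^sup>+ y. gagliardo_density p u y \<partial>lborel) \<le> 1;
      gagliardo_density p u x = ennreal g; 0 \<le> g\<rbrakk>
      \<Longrightarrow> \<exists>m::nat. 2 ^ m \<le> max 1 g \<and> \<bar>u x\<bar> powr (p / (p - 1)) \<le> D * (1 + real m)"
    using abs_powr_le_log_gagliardo_density[OF q p Q] by blast
  show thesis
  proof
    \<comment> \<open>With \<open>\<alpha> * D \<le> ln 2\<close> the exponential of
      \<open>\<alpha> * D * (1 + m)\<close> is at most \<open>2^(m + 1)\<close>; the cap 1 allows
      the factor \<open>\<alpha> ^ k\<close> to be dropped.\<close>
    show "0 < min 1 (ln 2 / D)" using \<open>0 < D\<close> by simp
    fix \<alpha> :: real and u :: "'a \<Rightarrow> real"
    assume \<alpha>: "0 < \<alpha>" "\<alpha> \<le> min 1 (ln 2 / D)" and [measurable]: "u \<in> borel_measurable borel"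
      and uQ: "(\<integral>\<^sup>+ x. ennreal (\<bar>u x\<bar> powr q) \<partial>lborel) \<le> ennreal Q"
      and uG: "(\<integral>\<^sup>+ y. gagliardo_density p u y \<partial>lborel) \<le> 1"
    let ?v = "\<lambda>x. \<bar>u x\<bar> powr (p / (p - 1))"
    have bound: "ennreal (trunc_exp k (\<alpha> * ?v x)) \<le> 2 * ennreal (\<bar>u x\<bar> powr q) + 2 * gagliardo_density p u x" for x
    proof (cases "gagliardo_density p u x")
      case (real g)
      then obtain m :: nat where m: "2 ^ m \<le> max 1 g" "?v x \<le> D * (1 + real m)"
        using D[OF _ uQ uG, of x g] by auto
      have "\<alpha> * ?v x \<le> ln 2 / D * (D * (1 + real m))"
        using \<alpha> m by (intro mult_mono) auto
      then have le: "\<alpha> * ?v x \<le> ln 2 * (1 + real m)" using \<open>0 < D\<close> by simp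
      have e: "exp (ln 2 * (1 + real m)) = 2 * (2::real) ^ m"
        using powr_realpow[of 2 "Suc m"] by (simp add: powr_def mult.commute)
      have "trunc_exp k (\<alpha> * ?v x) \<le> 2 * \<bar>u x\<bar> powr q + 2 * g"
      \<comment> \<open>If \<open>g \<le> 1\<close>, then \<open>m = 0\<close>, the exponential
        factor is at most 2 and the factor of order \<open>k\<close> gives \<open>|u|^q\<close>. If
        \<open>g > 1\<close>, the full exponential is at most
        \<open>2^(m + 1) \<le> 2 * g\<close>.\<close>
      proof (cases "g \<le> 1")
        case True
        then have "\<not> (2::real) ^ 1 < 2 ^ m" "(2::real) ^ m \<noteq> 2 ^ 1" using m(1) by auto
        then have "m = 0" by (simp only: power_strict_increasing_iff power_inject_exp)
        have "trunc_exp k (\<alpha> * ?v x) \<le> (\<alpha> * ?v x) ^ k * exp (\<alpha> * ?v x)"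
          using \<alpha> by (intro trunc_exp_le) auto
        also have "\<dots> \<le> (1 * ?v x) ^ k * 2"
          using \<alpha> le e \<open>m = 0\<close> by (intro mult_mono power_mono) (auto intro: mult_left_le_one_le order_trans[OF exp_le_cancel_iff[THEN iffD2]])
        also have "\<dots> = 2 * \<bar>u x\<bar> powr q"
        \<comment> \<open>At zeros of \<open>u\<close> both sides vanish, the left one because
          \<open>k \<ge> 1\<close>.\<close>
        proof (cases "u x = 0")
          case False
          then show ?thesis by (simp add: q_def powr_powr mult.commute flip: powr_realpow)
        qed (use k in auto)
        finally show ?thesis using real by simp
      next
        case False
        have "trunc_exp k (\<alpha> * ?v x) \<le> exp (\<alpha> * ?v x)"
          using \<alpha> by (intro trunc_exp_le_exp) auto
        also have "\<dots> \<le> exp (ln 2 * (1 + real m))" using le by simp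
        also have "\<dots> \<le> 2 * g" using m False e by simp
        finally show ?thesis by (simp add: add_increasing)
      qed
      then have "ennreal (trunc_exp k (\<alpha> * ?v x)) \<le> ennreal (2 * \<bar>u x\<bar> powr q + 2 * g)"
        by (rule ennreal_leI)
      then show ?thesis using real by (simp add: ennreal_mult)
    qed (simp add: ennreal_mult_eq_top_iff)
    have "(\<integral>\<^sup>+ x. ennreal (trunc_exp k (\<alpha> * ?v x)) \<partial>lborel)
        \<le> (\<integral>\<^sup>+ x. 2 * ennreal (\<bar>u x\<bar> powr q) + 2 * gagliardo_density p u x \<partial>lborel)"
      by (intro nn_integral_mono bound)
    also have "\<dots> = 2 * (\<integral>\<^sup>+ x. ennreal (\<bar>u x\<bar> powr q) \<partial>lborel) + 2 * (\<integral>\<^sup>+ x. gagliardo_density p u x \<partial>lborel)"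
      by (simp add: nn_integral_add nn_integral_cmult)
    also have "\<dots> \<le> 2 * ennreal Q + 2 * 1"
      using uQ uG by (intro add_mono mult_left_mono) auto
    finally show "(\<integral>\<^sup>+ x. ennreal (trunc_exp k (\<alpha> * ?v x)) \<partial>lborel) \<le> 2 * ennreal Q + 2" by simp
  qed
qed

section \<open>Positivity of the critical constant\<close>

text \<open>The value of a divergent series would be unspecified, so summability comes first: the
  terms are at most \<open>k powr (n - 1 - p)\<close> for \<open>k \<ge> 1\<close>, and
  \<open>p = n / s > n\<close> puts the exponent below -1.\<close>

lemma gamma_const_pos:
  assumes s: "0 < s" "s < 1" and n: "1 \<le> n"
  shows "0 < gamma_const s n"
proof -
  define p where "p = real n / s"
  define f :: "nat \<Rightarrow> real" where "f k = fact (n + k - 1) / (fact k * real (n + 2 * k) powr p)" for k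
  have p: "real n < p" using s n by (simp add: p_def field_simps)
  have f_pos: "0 < f k" for k using n by (simp add: f_def)
  have "summable f"
  proof (rule summable_comparison_test)
    show "summable (\<lambda>k. real k powr (real n - 1 - p))"
      using p by (subst summable_real_powr_iff) simp
    have "norm (f k) \<le> real k powr (real n - 1 - p)" if k: "1 \<le> k" for k
    proof -
      \<comment> \<open>The quotient is a product of \<open>n - 1\<close> factors, each at most
        \<open>n + k - 1\<close>.\<close>
      have "fact (n + k - 1) div fact k \<le> (n + k - 1) ^ (n - 1)"
        using fact_div_fact_le_pow[of "n - 1" "n + k - 1"] n by simp
      then have "real (fact (n + k - 1) div fact k) \<le> real ((n + k - 1) ^ (n - 1))"
        by (simp only: of_nat_le_iff)
      moreover have "real (fact (n + k - 1) div fact k) = fact (n + k - 1) / fact k"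
        using n by (subst real_of_nat_div) (auto intro!: fact_dvd)
      moreover have "real ((n + k - 1) ^ (n - 1)) \<le> real (n + 2 * k) ^ (n - 1)"
        unfolding of_nat_power by (intro power_mono) auto
      ultimately have "fact (n + k - 1) / fact k \<le> real (n + 2 * k) powr (real n - 1)"
        using n by (simp add: of_nat_diff flip: powr_realpow)
      then have "f k \<le> real (n + 2 * k) powr (real n - 1) / real (n + 2 * k) powr p"
        using n by (simp add: f_def divide_right_mono flip: divide_divide_eq_left)
      also have "\<dots> = real (n + 2 * k) powr (real n - 1 - p)"
        by (rule powr_diff[symmetric])
      also have "\<dots> \<le> real k powr (real n - 1 - p)"
        using p k by (intro powr_mono2') auto
      finally show ?thesis using f_pos[of k] by simp
    qed
    then show "\<exists>N. \<forall>k\<ge>N. norm (f k) \<le> real k powr (real n - 1 - p)" by blast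
  qed
  then have "0 < (\<Sum>k. f k)" using f_pos by (rule suminf_pos)
  moreover have "0 < sphere_area n" using n by (simp add: sphere_area_def Gamma_real_pos)
  moreover have "0 < Gamma (p + 1)" using p by (intro Gamma_real_pos) auto
  ultimately show ?thesis by (simp add: gamma_const_def p_def f_def Let_def)
qed

lemma alpha_star_pos: "\<lbrakk>0 < s; s < 1; 1 \<le> n\<rbrakk> \<Longrightarrow> 0 < alpha_star s n"
  using gamma_const_pos[of s n] by (simp add: alpha_star_def)

section \<open>Powers in \<open>[0, \<infinity>]\<close> and the norms for
  \<open>s p = n\<close>\<close>

lemma ennpowr_ennreal: "0 \<le> r \<Longrightarrow> ennpowr (ennreal r) a = ennreal (r powr a)"
  by (simp add: ennpowr_def)

lemma ennpowr_ennpowr: "ennpowr (ennpowr t a) b = ennpowr t (a * b)"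
  by (simp add: ennpowr_def powr_powr)

lemma ennpowr_0 [simp]: "ennpowr 0 a = 0"
  by (simp add: ennpowr_def)

lemma ennpowr_one [simp]: "ennpowr t 1 = t"
  by (cases t) (auto simp: ennpowr_def)

lemma ennpowr_less_top_iff [simp]: "ennpowr t a < top \<longleftrightarrow> t < top"
  by (auto simp: ennpowr_def less_top)

lemma ennpowr_eq_0_iff [simp]: "ennpowr t a = 0 \<longleftrightarrow> t = 0"
  by (cases t) (auto simp: ennpowr_def)

lemma ennpowr_mono: "t \<le> t' \<Longrightarrow> 0 \<le> a \<Longrightarrow> ennpowr t a \<le> ennpowr t' a"
  by (cases t; cases t') (auto simp: ennpowr_def top_unique intro!: ennreal_leI powr_mono2)

lemma ennpowr_le_1_iff:
  assumes "0 < a"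
  shows "ennpowr t a \<le> 1 \<longleftrightarrow> t \<le> 1"
proof
  assume "ennpowr t a \<le> 1"
  then have "ennpowr (ennpowr t a) (1 / a) \<le> ennpowr 1 (1 / a)"
    using assms by (intro ennpowr_mono) auto
  then show "t \<le> 1" using assms by (simp add: ennpowr_ennpowr) (simp add: ennpowr_def)
next
  assume "t \<le> 1"
  then have "ennpowr t a \<le> ennpowr 1 a" using assms by (intro ennpowr_mono) auto
  then show "ennpowr t a \<le> 1" by (simp add: ennpowr_def)
qed

lemma ennpowr_cmult: "0 < r \<Longrightarrow> ennpowr (ennreal r * t) a = ennreal (r powr a) * ennpowr t a"
  by (cases t) (auto simp: ennpowr_def ennreal_mult_top powr_mult simp flip: ennreal_mult)

lemma gagliardo_seminorm_eq:
  fixes u :: "real ^ 'n \<Rightarrow> real"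
  assumes "s * p = real CARD('n)"
  shows "gagliardo_seminorm s p u = ennpowr (\<integral>\<^sup>+ y. gagliardo_density p u y \<partial>lborel) (1 / p)"
proof -
  have "t powr (real CARD('n) + s * p) = t ^ (2 * CARD('n))" if "0 \<le> t" for t
    using that assms powr_realpow[of t "2 * CARD('n)"] by (cases "t = 0") auto
  then show ?thesis by (simp add: gagliardo_seminorm_def gagliardo_density_def)
qed

lemma sobolev_norm_eq:
  fixes u :: "real ^ 'n \<Rightarrow> real"
  assumes "s * p = real CARD('n)" "1 < p"
  shows "sobolev_norm s p u =
    ennpowr ((\<integral>\<^sup>+ x. ennreal (\<bar>u x\<bar> powr p) \<partial>lborel) + (\<integral>\<^sup>+ y. gagliardo_density p u y \<partial>lborel)) (1 / p)"
  using assms by (simp add: sobolev_norm_def lp_norm_def gagliardo_seminorm_eq ennpowr_ennpowr)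

section \<open>Homogeneity and basic properties of the closure of the test functions\<close>

lemma nn_integral_gagliardo_density_cmult:
  fixes u :: "'a::euclidean_space \<Rightarrow> real"
  assumes [measurable]: "u \<in> borel_measurable borel"
  shows "(\<integral>\<^sup>+ y. gagliardo_density p (\<lambda>x. c * u x) y \<partial>lborel)
    = ennreal (\<bar>c\<bar> powr p) * (\<integral>\<^sup>+ y. gagliardo_density p u y \<partial>lborel)"
proof -
  have "gagliardo_density p (\<lambda>x. c * u x) y = ennreal (\<bar>c\<bar> powr p) * gagliardo_density p u y" for y
    unfolding gagliardo_density_def
    by (subst nn_integral_cmult[symmetric])
      (auto intro!: nn_integral_cong simp: abs_mult powr_mult simp flip: ennreal_mult right_diff_distrib)
  then show ?thesis by (simp add: nn_integral_cmult)
qed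

lemma sobolev_norm_cmult:
  fixes u :: "real ^ 'n \<Rightarrow> real"
  assumes [measurable]: "u \<in> borel_measurable borel"
    and "s * p = real CARD('n)" "1 < p" "0 < c"
  shows "sobolev_norm s p (\<lambda>x. c * u x) = ennreal c * sobolev_norm s p u"
proof -
  have "(\<integral>\<^sup>+ x. ennreal (\<bar>c * u x\<bar> powr p) \<partial>lborel)
      = ennreal (c powr p) * (\<integral>\<^sup>+ x. ennreal (\<bar>u x\<bar> powr p) \<partial>lborel)"
    using assms by (subst nn_integral_cmult[symmetric])
      (auto intro!: nn_integral_cong simp: abs_mult powr_mult simp flip: ennreal_mult)
  then show ?thesis
    using assms by (simp add: sobolev_norm_eq nn_integral_gagliardo_density_cmult ennpowr_cmult powr_powr
      flip: distrib_left)
qed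

lemma cont_diff_cmult: "cont_diff m f \<Longrightarrow> cont_diff m (\<lambda>x. c * f x)"
proof (induction m arbitrary: f)
  case 0
  then show ?case by (auto intro: continuous_intros)
next
  case (Suc m)
  have "frechet_derivative (\<lambda>x. c * f x) (at x) = (\<lambda>v. c * frechet_derivative f (at x) v)" for x
  proof -
    have "(f has_derivative frechet_derivative f (at x)) (at x)"
      using Suc.prems frechet_derivative_works by auto
    then show ?thesis
      by (intro frechet_derivative_at[symmetric]) (rule has_derivative_mult_right)
  qed
  then show ?case using Suc by auto
qed

lemma test_functions_cmult:
  assumes "\<phi> \<in> test_functions \<Omega>" "c \<noteq> 0"
  shows "(\<lambda>x. c * \<phi> x) \<in> test_functions \<Omega>"
proof -
  have "support_on UNIV (\<lambda>x. c * \<phi> x) = support_on UNIV \<phi>"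
    using assms by (auto simp: support_on_def)
  then show ?thesis using assms by (auto simp: test_functions_def cont_diff_cmult)
qed

lemma test_functions_measurable: "\<phi> \<in> test_functions \<Omega> \<Longrightarrow> \<phi> \<in> borel_measurable borel"
  by (auto simp: test_functions_def intro!: borel_measurable_continuous_onI dest: spec[of _ 0])

lemma test_functions_eq_0: "\<phi> \<in> test_functions \<Omega> \<Longrightarrow> x \<notin> \<Omega> \<Longrightarrow> \<phi> x = 0"
  using closure_subset[of "support_on UNIV \<phi>"] by (auto simp: test_functions_def support_on_def)

text \<open>If \<open>\<phi>\<close> approximates \<open>u\<close> within
  \<open>\<epsilon> / c\<close>, then \<open>c * \<phi>\<close> approximates \<open>c * u\<close>
  within \<open>\<epsilon>\<close>. This permits normalising the seminorm.\<close>

lemma sobolev_space0_cmult: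
  fixes u :: "real ^ 'n \<Rightarrow> real"
  assumes u: "u \<in> sobolev_space0 s p \<Omega>" and sp: "s * p = real CARD('n)" "1 < p" and c: "0 < c"
  shows "(\<lambda>x. c * u x) \<in> sobolev_space0 s p \<Omega>"
proof -
  have m[measurable]: "u \<in> borel_measurable borel"
    using u by (simp add: sobolev_space0_def sobolev_space_def)
  have "\<exists>\<phi>\<in>test_functions \<Omega>. sobolev_norm s p (\<lambda>x. c * u x - \<phi> x) < ennreal \<epsilon>" if "\<epsilon> > 0" for \<epsilon>
  proof -
    have "0 < \<epsilon> / c" using that c by simp
    then obtain \<phi> where \<phi>: "\<phi> \<in> test_functions \<Omega>" "sobolev_norm s p (\<lambda>x. u x - \<phi> x) < ennreal (\<epsilon> / c)"
      using u by (auto simp: sobolev_space0_def)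
    note [measurable] = test_functions_measurable[OF \<phi>(1)]
    have "sobolev_norm s p (\<lambda>x. c * (u x - \<phi> x)) = ennreal c * sobolev_norm s p (\<lambda>x. u x - \<phi> x)"
      using sp c by (intro sobolev_norm_cmult) auto
    also have "\<dots> < ennreal c * ennreal (\<epsilon> / c)"
      using \<phi> c by (intro ennreal_mult_strict_left_mono) auto
    also have "\<dots> = ennreal \<epsilon>" using c that by (simp flip: ennreal_mult)
    finally show ?thesis
      using c \<phi> by (intro bexI[of _ "\<lambda>x. c * \<phi> x"] test_functions_cmult) (auto simp: right_diff_distrib)
  qed
  moreover have "sobolev_norm s p (\<lambda>x. c * u x) < \<infinity>"
    using u sp c by (subst sobolev_norm_cmult[OF m])
      (auto simp: sobolev_space0_def sobolev_space_def ennreal_mult_less_top)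
  ultimately show ?thesis by (simp add: sobolev_space0_def sobolev_space_def)
qed

text \<open>Off \<open>\<Omega>\<close> an approximating test function is 0, so the
  \<open>L^p\<close> norm of \<open>u\<close> there is at most the approximation error. Integrals
  over \<open>\<Omega>\<close> can thus be exchanged for integrals over the whole space.\<close>

lemma sobolev_space0_AE_eq_0:
  fixes u :: "real ^ 'n \<Rightarrow> real"
  assumes u: "u \<in> sobolev_space0 s p \<Omega>" and sp: "s * p = real CARD('n)" "1 < p" and "open \<Omega>"
  shows "AE x in lborel. x \<notin> \<Omega> \<longrightarrow> u x = 0"
proof -
  have [measurable]: "u \<in> borel_measurable borel" "\<Omega> \<in> sets borel"
    using assms by (simp_all add: sobolev_space0_def sobolev_space_def)
  let ?J = "\<integral>\<^sup>+ x\<in>- \<Omega>. ennreal (\<bar>u x\<bar> powr p) \<partial>lborel"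
  have J: "ennpowr ?J (1 / p) \<le> ennreal \<epsilon>" if "\<epsilon> > 0" for \<epsilon>
  proof -
    obtain \<phi> where \<phi>: "\<phi> \<in> test_functions \<Omega>" "sobolev_norm s p (\<lambda>x. u x - \<phi> x) < ennreal \<epsilon>"
      using u \<open>\<epsilon> > 0\<close> by (auto simp: sobolev_space0_def)
    have "?J \<le> (\<integral>\<^sup>+ x. ennreal (\<bar>u x - \<phi> x\<bar> powr p) \<partial>lborel)"
      by (intro nn_integral_mono) (auto simp: indicator_def test_functions_eq_0[OF \<phi>(1)])
    then have "ennpowr ?J (1 / p) \<le> sobolev_norm s p (\<lambda>x. u x - \<phi> x)"
      unfolding sobolev_norm_eq[OF sp] using sp by (intro ennpowr_mono) (auto intro: add_increasing2)
    then show ?thesis using \<phi> by simp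
  qed
  have "ennpowr ?J (1 / p) \<le> 0"
    by (rule ennreal_le_epsilon) (use J in simp)
  then have "?J = 0" by simp
  then have "AE x in lborel. ennreal (\<bar>u x\<bar> powr p) * indicator (- \<Omega>) x = 0"
    by (subst (asm) nn_integral_0_iff_AE) auto
  then show ?thesis by eventually_elim (auto simp: indicator_def)
qed

text \<open>Zero energy forces \<open>u\<close> to agree almost everywhere with a single value
  \<open>u y\<close>, and a nonzero constant is not p-integrable on a space of infinite
  measure.\<close>

lemma nn_integral_gagliardo_density_eq_0:
  fixes u :: "'a::euclidean_space \<Rightarrow> real"
  assumes [measurable]: "u \<in> borel_measurable borel"
    and 0: "(\<integral>\<^sup>+ y. gagliardo_density p u y \<partial>lborel) = 0"
    and fin: "(\<integral>\<^sup>+ x. ennreal (\<bar>u x\<bar> powr p) \<partial>lborel) < \<infinity>"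
  shows "AE x in lborel. u x = 0"
proof -
  have "AE y in lborel. gagliardo_density p u y = 0"
    using 0 by (subst (asm) nn_integral_0_iff_AE) auto
  moreover have "ae_filter (lborel :: 'a measure) \<noteq> bot"
    by (simp add: ae_filter_eq_bot_iff)
  ultimately obtain y where "gagliardo_density p u y = 0"
    using eventually_happens' by blast
  then have "AE x in lborel. ennreal (\<bar>u x - u y\<bar> powr p / norm (x - y) ^ (2 * DIM('a))) = 0"
    unfolding gagliardo_density_def by (subst (asm) nn_integral_0_iff_AE) auto
  then have c: "AE x in lborel. u x = u y"
  proof eventually_elim
    fix x assume "ennreal (\<bar>u x - u y\<bar> powr p / norm (x - y) ^ (2 * DIM('a))) = 0"
    then have "\<not> 0 < \<bar>u x - u y\<bar> powr p / norm (x - y) ^ (2 * DIM('a))"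
      by (simp add: ennreal_eq_0_iff not_less)
    moreover have "0 < \<bar>u x - u y\<bar> powr p / norm (x - y) ^ (2 * DIM('a))" if "u x \<noteq> u y"
      using that by (intro divide_pos_pos zero_less_power) auto
    ultimately show "u x = u y" by blast
  qed
  then have "(\<integral>\<^sup>+ x. ennreal (\<bar>u x\<bar> powr p) \<partial>lborel) = (\<integral>\<^sup>+ (x::'a). ennreal (\<bar>u y\<bar> powr p) \<partial>lborel)"
    by (intro nn_integral_cong_AE) (auto elim: eventually_mono)
  with fin have "u y = 0" by (auto simp: ennreal_mult_less_top)
  with c show ?thesis by simp
qed

section \<open>The equivalence of the two inequalities\<close>

theorem theorem1p1:
  fixes k :: nat and s p :: real and \<Omega> :: "(real ^ 'n) set"
  assumes "k \<ge> 1" and "open \<Omega>" and "0 < s" and "s < 1" and "1 < p" and "s * p = real CARD('n)"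
  shows
    "(\<exists>\<alpha>. 0 < \<alpha> \<and> \<alpha> < alpha_star s CARD('n) \<and>
        (SUP u \<in> {u \<in> sobolev_space0 s p \<Omega>. gagliardo_seminorm s p u \<le> 1}.
           \<integral>\<^sup>+ x\<in>\<Omega>. ennreal (trunc_exp k (\<alpha> * \<bar>u x\<bar> powr (p / (p - 1)))) \<partial>lborel) < \<infinity>)
     \<longleftrightarrow>
     (INF u \<in> {u \<in> sobolev_space0 s p \<Omega>. \<not> (AE x in lborel. u x = 0)}.
        (\<integral>\<^sup>+ y. (\<integral>\<^sup>+ x. ennreal (\<bar>u x - u y\<bar> powr p / norm (x - y) ^ (2 * CARD('n))) \<partial>lborel) \<partial>lborel)
        / ennpowr (\<integral>\<^sup>+ x\<in>\<Omega>. ennreal (\<bar>u x\<bar> powr (real k * p / (p - 1))) \<partial>lborel) ((p - 1) / real k)) > 0"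
proof -
  note sp = \<open>s * p = real CARD('n)\<close> \<open>1 < p\<close>
  let ?X = "sobolev_space0 s p \<Omega>"
  define E :: "(real ^ 'n \<Rightarrow> real) \<Rightarrow> ennreal" where "E u = (\<integral>\<^sup>+ y. gagliardo_density p u y \<partial>lborel)" for u
  define q where "q = real k * p / (p - 1)"
  define r where "r = (p - 1) / real k"
  define I where "I u = (\<integral>\<^sup>+ x\<in>\<Omega>. ennreal (\<bar>u x\<bar> powr q) \<partial>lborel)" for u :: "real ^ 'n \<Rightarrow> real"
  define MT where "MT \<alpha> = (SUP u \<in> {u \<in> ?X. gagliardo_seminorm s p u \<le> 1}.
      \<integral>\<^sup>+ x\<in>\<Omega>. ennreal (trunc_exp k (\<alpha> * \<bar>u x\<bar> powr (p / (p - 1)))) \<partial>lborel)" for \<alpha>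
  define P where "P = (INF u \<in> {u \<in> ?X. \<not> (AE x in lborel. u x = 0)}. E u / ennpowr (I u) r)"
  \<comment> \<open>The relation \<open>q * r = p\<close> makes \<open>E u\<close> and
    \<open>ennpowr (I u) r\<close> scale alike, so the quotient in \<open>P\<close> is invariant
    under positive multiples of \<open>u\<close>.\<close>
  have r: "0 < r" and q: "0 < q" and qr: "q / p * r = 1"
    using assms by (simp_all add: r_def q_def)
  have [measurable]: "\<Omega> \<in> sets borel" using \<open>open \<Omega>\<close> by simp
  have meas: "u \<in> borel_measurable borel" if "u \<in> ?X" for u
    using that by (simp add: sobolev_space0_def sobolev_space_def)
  have fin: "(\<integral>\<^sup>+ x. ennreal (\<bar>u x\<bar> powr p) \<partial>lborel) < \<infinity>" "E u < \<infinity>" if "u \<in> ?X" for u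
    using that unfolding sobolev_space0_def sobolev_space_def
    by (auto simp: sobolev_norm_eq[OF sp] E_def)
  have seminorm: "gagliardo_seminorm s p u \<le> 1 \<longleftrightarrow> E u \<le> 1" for u :: "real ^ 'n \<Rightarrow> real"
    using sp by (simp add: gagliardo_seminorm_eq ennpowr_le_1_iff E_def)

  have "0 < P" if \<alpha>: "0 < \<alpha>" "MT \<alpha> < \<infinity>" for \<alpha>
  proof -
    obtain S where S: "0 \<le> S" "MT \<alpha> = ennreal S" using \<alpha> by (cases "MT \<alpha>") auto
    \<comment> \<open>The summand 1 keeps \<open>C\<close> positive even if
      \<open>S = 0\<close>.\<close>
    define C where "C = S * fact k / \<alpha> ^ k + 1"
    have C: "0 < C" using S \<alpha> by (auto simp: C_def intro!: add_nonneg_pos)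
    have "ennreal (1 / C powr r) \<le> E u / ennpowr (I u) r"
      if u: "u \<in> ?X" and nz: "\<not> (AE x in lborel. u x = 0)" for u
    proof -
      note [measurable] = meas[OF u]
      obtain N where N: "0 \<le> N" "E u = ennreal N" using fin[OF u] by (cases "E u") auto
      have "N \<noteq> 0"
        using nn_integral_gagliardo_density_eq_0[OF meas[OF u] _ fin(1)[OF u]] nz N by (auto simp: E_def)
      with N have "0 < N" by simp
      \<comment> \<open>The normalisation \<open>E (t u) = t^p * N = 1\<close> makes
        \<open>t u\<close> admissible in \<open>MT\<close>.\<close>
      define t where "t = N powr (- 1 / p)"
      have t: "0 < t" "t powr p * N = 1" "t powr q * N powr (q / p) = 1"
        using \<open>0 < N\<close> sp by (simp_all add: t_def powr_powr) (simp_all add: powr_minus)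
      have "E (\<lambda>x. t * u x) \<le> 1"
        unfolding E_def using t N
        by (subst nn_integral_gagliardo_density_cmult) (auto simp: E_def simp flip: ennreal_mult)
      then have "(\<integral>\<^sup>+ x\<in>\<Omega>. ennreal (trunc_exp k (\<alpha> * \<bar>t * u x\<bar> powr (p / (p - 1)))) \<partial>lborel) \<le> MT \<alpha>"
        unfolding MT_def using sobolev_space0_cmult[OF u sp t(1)] seminorm
        by (intro SUP_upper2[of "\<lambda>x. t * u x"]) auto
      moreover have "ennreal (\<alpha> ^ k / fact k * t powr q) * I u
          \<le> (\<integral>\<^sup>+ x\<in>\<Omega>. ennreal (trunc_exp k (\<alpha> * \<bar>t * u x\<bar> powr (p / (p - 1)))) \<partial>lborel)"
        unfolding I_def
      proof (subst nn_integral_cmult[symmetric]; (intro nn_integral_mono)?)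
        fix x
        have "\<alpha> ^ k / fact k * t powr q * \<bar>u x\<bar> powr q \<le> trunc_exp k (\<alpha> * \<bar>t * u x\<bar> powr (p / (p - 1)))"
        proof (cases "u x = 0")
          case True
          then show ?thesis using trunc_exp_ge[of 0 k] assms by (simp add: power_0_left)
        next
          case False
          then have "\<alpha> ^ k / fact k * t powr q * \<bar>u x\<bar> powr q = (\<alpha> * \<bar>t * u x\<bar> powr (p / (p - 1))) ^ k / fact k"
            using t(1) by (simp add: power_mult_distrib abs_mult powr_mult powr_powr q_def mult.commute
              flip: powr_realpow)
          also have "\<dots> \<le> trunc_exp k (\<alpha> * \<bar>t * u x\<bar> powr (p / (p - 1)))"
            using \<alpha> by (intro trunc_exp_ge) auto
          finally show ?thesis .
        qed
        then show "ennreal (\<alpha> ^ k / fact k * t powr q) * (ennreal (\<bar>u x\<bar> powr q) * indicator \<Omega> x)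
            \<le> ennreal (trunc_exp k (\<alpha> * \<bar>t * u x\<bar> powr (p / (p - 1)))) * indicator \<Omega> x"
          using \<alpha> by (auto simp: indicator_def ennreal_leI simp flip: ennreal_mult)
      qed auto
      ultimately have le: "ennreal (\<alpha> ^ k / fact k * t powr q) * I u \<le> ennreal S"
        using S by simp
      moreover have "0 < \<alpha> ^ k / fact k * t powr q" using \<alpha> t by simp
      ultimately have "I u \<noteq> \<infinity>" using \<alpha> t by (auto simp: ennreal_mult_top top_unique)
      then obtain J where J: "0 \<le> J" "I u = ennreal J" by (cases "I u") auto
      have "\<alpha> ^ k / fact k * t powr q * J \<le> S"
        using le J S \<alpha> by (simp flip: ennreal_mult)
      then have "t powr q * J \<le> S * fact k / \<alpha> ^ k"
        using \<alpha> by (simp add: field_simps)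
      also have "\<dots> \<le> C" by (simp add: C_def)
      finally have "N powr (q / p) * (t powr q * J) \<le> N powr (q / p) * C"
        by (intro mult_left_mono) auto
      moreover have "N powr (q / p) * (t powr q * J) = J" using t(3) by (simp add: mult_ac)
      ultimately have "J powr r \<le> (N powr (q / p) * C) powr r"
        using J r by (intro powr_mono2) auto
      also have "\<dots> = N * C powr r"
        unfolding powr_mult powr_powr qr using \<open>0 < N\<close> by simp
      finally have le: "J powr r \<le> N * C powr r" .
      show ?thesis
      \<comment> \<open>For \<open>J = 0\<close> the quotient is a positive number over 0, which is
        \<open>\<infinity>\<close> in \<open>ennreal\<close>.\<close>
      proof (cases "J = 0")
        case True
        then show ?thesis using \<open>0 < N\<close> N J by (simp add: ennpowr_ennreal)
      next
        case False
        then have "1 / C powr r \<le> N / J powr r"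
          using le C J by (simp add: field_simps)
        then show ?thesis using False J N by (simp add: ennpowr_ennreal divide_ennreal ennreal_leI)
      qed
    qed
    then have "ennreal (1 / C powr r) \<le> P" unfolding P_def by (intro INF_greatest) auto
    moreover have "0 < ennreal (1 / C powr r)" using C by simp
    ultimately show "0 < P" by (rule less_le_trans[rotated])
  qed
  moreover have "\<exists>\<alpha>. 0 < \<alpha> \<and> \<alpha> < alpha_star s CARD('n) \<and> MT \<alpha> < \<infinity>" if P: "0 < P"
  proof -
    obtain z where "0 < z" "z < P" using dense[OF P] by blast
    then obtain c where c: "0 < c" "ennreal c < P" by (cases z) auto
    \<comment> \<open>From \<open>c < E u / (I u)^r\<close> and \<open>E u \<le> 1\<close> follows
      \<open>(I u)^r \<le> 1 / c\<close>.\<close>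
    define Q where "Q = (1 / c) powr (1 / r)"
    have "0 \<le> Q" by (simp add: Q_def)
    have IQ: "I u \<le> ennreal Q" if u: "u \<in> ?X" and E1: "E u \<le> 1" for u
    proof (cases "AE x in lborel. u x = 0")
      case True
      then have "I u = (\<integral>\<^sup>+ (x :: real ^ 'n). 0 \<partial>lborel)"
        unfolding I_def by (intro nn_integral_cong_AE) (auto elim: eventually_mono)
      then show ?thesis by simp
    next
      case False
      then have "P \<le> E u / ennpowr (I u) r"
        unfolding P_def using u by (intro INF_lower) auto
      with c have le: "ennreal c < E u / ennpowr (I u) r" by simp
      \<comment> \<open>If \<open>I u\<close> were infinite, the quotient would be 0, contradicting
        the lower bound \<open>c\<close>.\<close>
      then have "I u \<noteq> \<infinity>" by (auto simp: ennpowr_def)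
      then obtain J where J: "0 \<le> J" "I u = ennreal J" by (cases "I u") auto
      show ?thesis
      proof (cases "J = 0")
        case False
        obtain N where N: "0 \<le> N" "E u = ennreal N" using fin[OF u] by (cases "E u") auto
        then have "c < N / J powr r" "N \<le> 1"
          using le J False c E1 by (simp_all add: ennpowr_ennreal divide_ennreal ennreal_less_iff)
        then have "J powr r \<le> 1 / c" using c False J by (simp add: field_simps)
        then have "J \<le> Q" unfolding Q_def using J r by (intro le_powr_inverse) auto
        then show ?thesis using J by (simp add: ennreal_leI)
      qed (use J in simp)
    qed
    obtain \<beta> where "0 < \<beta>" and \<beta>: "\<And>\<alpha> (u :: real ^ 'n \<Rightarrow> real). \<lbrakk>0 < \<alpha>; \<alpha> \<le> \<beta>; u \<in> borel_measurable borel;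
      (\<integral>\<^sup>+ x. ennreal (\<bar>u x\<bar> powr q) \<partial>lborel) \<le> ennreal Q; E u \<le> 1\<rbrakk>
      \<Longrightarrow> (\<integral>\<^sup>+ x. ennreal (trunc_exp k (\<alpha> * \<bar>u x\<bar> powr (p / (p - 1)))) \<partial>lborel) \<le> 2 * ennreal Q + 2"
      unfolding E_def q_def using trudinger_inequality[OF \<open>1 < p\<close> \<open>k \<ge> 1\<close> \<open>0 \<le> Q\<close>] by blast
    have star: "0 < alpha_star s CARD('n)" using assms by (intro alpha_star_pos) (auto simp: Suc_leI)
    \<comment> \<open>Halving gives the strict inequality below \<open>alpha_star\<close>.\<close>
    define \<alpha> where "\<alpha> = min \<beta> (alpha_star s CARD('n) / 2)"
    have \<alpha>: "0 < \<alpha>" "\<alpha> \<le> \<beta>" "\<alpha> < alpha_star s CARD('n)"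
      using star \<open>0 < \<beta>\<close> by (auto simp: \<alpha>_def)
    have "MT \<alpha> \<le> 2 * ennreal Q + 2"
      unfolding MT_def
    proof (rule SUP_least)
      fix u assume "u \<in> {u \<in> ?X. gagliardo_seminorm s p u \<le> 1}"
      then have u: "u \<in> ?X" and E1: "E u \<le> 1" by (auto simp: seminorm)
      \<comment> \<open>The inequality behind \<open>\<beta>\<close> needs the
        \<open>q\<close>-integral over the whole space, while \<open>IQ\<close> bounds it over
        \<open>\<Omega>\<close>; they agree because \<open>u\<close> vanishes almost everywhere
        outside.\<close>
      have "AE x in lborel. ennreal (\<bar>u x\<bar> powr q) = ennreal (\<bar>u x\<bar> powr q) * indicator \<Omega> x"
        using sobolev_space0_AE_eq_0[OF u sp \<open>open \<Omega>\<close>] by eventually_elim (auto simp: indicator_def)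
      then have "(\<integral>\<^sup>+ x. ennreal (\<bar>u x\<bar> powr q) \<partial>lborel) = I u"
        unfolding I_def by (rule nn_integral_cong_AE)
      then have "(\<integral>\<^sup>+ x. ennreal (trunc_exp k (\<alpha> * \<bar>u x\<bar> powr (p / (p - 1)))) \<partial>lborel) \<le> 2 * ennreal Q + 2"
        using IQ[OF u E1] \<alpha> meas[OF u] E1 by (intro \<beta>) auto
      moreover have "(\<integral>\<^sup>+ x\<in>\<Omega>. ennreal (trunc_exp k (\<alpha> * \<bar>u x\<bar> powr (p / (p - 1)))) \<partial>lborel)
          \<le> (\<integral>\<^sup>+ x. ennreal (trunc_exp k (\<alpha> * \<bar>u x\<bar> powr (p / (p - 1)))) \<partial>lborel)"
        by (intro nn_integral_mono) (auto simp: indicator_def)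
      ultimately show "(\<integral>\<^sup>+ x\<in>\<Omega>. ennreal (trunc_exp k (\<alpha> * \<bar>u x\<bar> powr (p / (p - 1)))) \<partial>lborel)
          \<le> 2 * ennreal Q + 2" by (rule order_trans[rotated])
    qed
    also have "\<dots> < \<infinity>" by (simp add: ennreal_mult_less_top)
    finally show ?thesis using \<alpha> by auto
  qed
  ultimately have "(\<exists>\<alpha>. 0 < \<alpha> \<and> \<alpha> < alpha_star s CARD('n) \<and> MT \<alpha> < \<infinity>) \<longleftrightarrow> 0 < P"
    by blast
  then show ?thesis
    by (simp add: MT_def P_def E_def I_def q_def r_def gagliardo_density_def)
qed

end
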